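(* Let $\alpha\in\mathbb{R}$, let $n\ge0$ be an integer, let $c\in\mathbb{R}$ and let $\Omega\subset\mathbb{R}$ be a parameter set having $c$ as a limit point. For each $\omega\in\Omega$ let $\phi(\cdot,\alpha,\omega)$ be a compactly supported distribution on $\mathbb{R}$ whose Laplace transform $\widehat\phi(\cdot,\alpha,\omega)$ satisfies $\widehat\phi(0,\alpha,\omega)\ne0$. Suppose there is a constant $0<r<1$ such that for every $\varepsilon>0$ there exists $\delta>0$ such that for all $\omega\in\Omega$ with $|\omega-c|<\delta$ $$\left|\widehat\phi\!\left(\frac{z}{1-z},\alpha,\omega\right)-(1-z)^{\alpha+n+1}\right|\le\varepsilon\qquad\text{for all }z\in\mathbb{C},\ |z|<r.$$ Let $\{P_m(x,\alpha,\omega):m=0,1,\dots\}$ be the polynomials in $x$ generated, for $z$ near $0$, by $$\frac{e^{-\frac{zx}{1-z}}(1-z)^n}{\widehat\phi\!\left(\frac{z}{1-z},\alpha,\omega\right)}=\sum_{m=0}^\infty P_m(x,\alpha,\omega)z^m .$$ Then for each $m=0,1,2,\dots$, $P_m(x,\alpha,\omega)$ converges to the generalized Laguerre polynomial $L_m^{(\alpha)}(x)$ locally uniformly in $x$ as $\omega\to c$.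
   Context: The Laplace transform of a compactly supported distribution $\phi$ is $\widehat\phi(s)=\langle\phi,e^{-s(\cdot)}\rangle$, $s\in\mathbb{C}$. The generalized Laguerre polynomials are defined by $(1-z)^{-\alpha-1}e^{-\frac{zx}{1-z}}=\sum_{m=0}^\infty L_m^{(\alpha)}(x)z^m$ for $|z|<1$. Powers of $1-z$ for $|z|<1$ are principal branches. *)

theory Defs
  imports "HOL-Complex_Analysis.Complex_Analysis" "HOL-Computational_Algebra.Polynomial"
begin

definition nth_vderiv :: "nat \<Rightarrow> (real \<Rightarrow> complex) \<Rightarrow> real \<Rightarrow> complex"
  where "nth_vderiv k = ((\<lambda>f x. vector_derivative f (at x)) ^^ k)"

definition smooth :: "(real \<Rightarrow> complex) \<Rightarrow> bool"
  where "smooth f \<longleftrightarrow> (\<forall>k x. nth_vderiv k f differentiable (at x))"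

text \<open>
  The compactly supported distributions on the real line are the elements of the dual
  \<open>E'\<close> of the Frechet space of all smooth functions, so that they can be paired with
  non-compactly supported smooth functions such as exponentials.  The last conjunct is continuity
  with respect to the seminorms given by suprema of derivatives over compact sets.  Functionals are
  total in HOL; their values at non-smooth functions are irrelevant.
\<close>

definition compactly_supported_distribution :: "((real \<Rightarrow> complex) \<Rightarrow> complex) \<Rightarrow> bool"
  where "compactly_supported_distribution \<phi> \<longleftrightarrow>
    (\<forall>f g. smooth f \<longrightarrow> smooth g \<longrightarrow> \<phi> (\<lambda>x. f x + g x) = \<phi> f + \<phi> g) \<and>
    (\<forall>a f. smooth f \<longrightarrow> \<phi> (\<lambda>x. a * f x) = a * \<phi> f) \<and>
    (\<exists>K N C. compact K \<and> K \<noteq> {} \<and>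
       (\<forall>f. smooth f \<longrightarrow> norm (\<phi> f) \<le> C * (\<Sum>k\<le>N. SUP x\<in>K. norm (nth_vderiv k f x))))"

definition laplace_transform :: "((real \<Rightarrow> complex) \<Rightarrow> complex) \<Rightarrow> complex \<Rightarrow> complex"
  where "laplace_transform \<phi> s = \<phi> (\<lambda>x. exp (- (s * complex_of_real x)))"

definition laguerre_gf :: "real \<Rightarrow> complex \<Rightarrow> complex \<Rightarrow> complex"
  where "laguerre_gf \<alpha> x z =
    (1 - z) powr complex_of_real (- \<alpha> - 1) * exp (- (z * x / (1 - z)))"

text \<open>
  The sequence of polynomials determined by the generating function; the definite description is
  justified by \<open>laguerre_unique_existence\<close> below.
\<close>

definition gen_laguerre :: "real \<Rightarrow> nat \<Rightarrow> complex poly"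
  where "gen_laguerre \<alpha> = (THE L. \<forall>x z. norm z < 1 \<longrightarrow>
    (\<lambda>m. poly (L m) x * z ^ m) sums laguerre_gf \<alpha> x z)"

lemma laguerre_gf_deriv:
  assumes "z \<in> ball 0 1"
  shows "(laguerre_gf \<alpha> x has_field_derivative
     (complex_of_real (\<alpha> + 1) / (1 - z) - x / (1 - z)^2) * laguerre_gf \<alpha> x z) (at z)"
proof -
  have re: "Re (1 - z) > 0"
    using assms abs_Re_le_cmod[of z] by (auto simp: dist_norm)
  hence nz: "1 - z \<noteq> 0" "1 - z \<notin> \<real>\<^sub>\<le>\<^sub>0"
    by (auto simp: complex_nonpos_Reals_iff)
  have pd: "((\<lambda>z. (1 - z) powr a) has_field_derivative - a / (1 - z) * (1 - z) powr a) (at z)"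
    for a :: complex
  proof -
    have d: "((\<lambda>z. 1 - z) has_field_derivative - 1) (at z)"
      by (rule DERIV_cong[OF DERIV_diff[OF DERIV_const DERIV_ident]]) simp
    have "((\<lambda>z. (1 - z) powr a) has_field_derivative a * (1 - z) powr (a - 1) * (- 1)) (at z)"
      using DERIV_chain2[where f = "\<lambda>w. w powr a" and g = "\<lambda>z. 1 - z",
          OF has_field_derivative_powr[OF nz(2)] d] .
    moreover have "(1 - z) powr (a - 1) = (1 - z) powr a / (1 - z)"
      using nz(1) by (subst powr_diff) simp
    ultimately show ?thesis by simp
  qed
  have d1: "((\<lambda>z. (1 - z) powr complex_of_real (- \<alpha> - 1)) has_field_derivative
      complex_of_real (\<alpha> + 1) / (1 - z) * (1 - z) powr complex_of_real (- \<alpha> - 1)) (at z)"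
  proof -
    have "- complex_of_real (- \<alpha> - 1) = complex_of_real (\<alpha> + 1)" by simp
    thus ?thesis using pd[of "complex_of_real (- \<alpha> - 1)"] by (simp only:)
  qed
  have d2: "((\<lambda>z. exp (- (z * x / (1 - z)))) has_field_derivative
      - (x / (1 - z)^2) * exp (- (z * x / (1 - z)))) (at z)"
  proof -
    have "((\<lambda>z. z * x) has_field_derivative x) (at z)"
      by (rule DERIV_cong[OF DERIV_cmult_right[OF DERIV_ident]]) simp
    moreover have "((\<lambda>z. 1 - z) has_field_derivative - 1) (at z)"
      by (rule DERIV_cong[OF DERIV_diff[OF DERIV_const DERIV_ident]]) simp
    ultimately have "((\<lambda>z. - (z * x / (1 - z))) has_field_derivative
        - ((x * (1 - z) - z * x * (- 1)) / ((1 - z) * (1 - z)))) (at z)"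
      by (intro DERIV_minus DERIV_divide nz(1))
    moreover have "- ((x * (1 - z) - z * x * (- 1)) / ((1 - z) * (1 - z))) = - (x / (1 - z)^2)"
      by (simp add: power2_eq_square right_diff_distrib)
    ultimately show ?thesis
      by (metis DERIV_chain2 DERIV_exp mult.commute)
  qed
  have "B * E * D + - C * D * E = (B - C) * (E * D)" for B C D E :: complex
    by (simp add: algebra_simps)
  thus ?thesis
    unfolding laguerre_gf_def[abs_def] by (rule DERIV_cong[OF DERIV_mult[OF d1 d2]])
qed

lemma laguerre_gf_nth_deriv:
  "\<exists>c. (\<forall>k. c k holomorphic_on ball 0 1) \<and>
     (\<forall>x. \<forall>z\<in>ball 0 1. (deriv ^^ m) (laguerre_gf \<alpha> x) z
        = (\<Sum>k\<le>m. c k z * x ^ k) * laguerre_gf \<alpha> x z)"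
proof (induction m)
  case 0
  show ?case by (rule exI[of _ "\<lambda>_ _. 1"]) auto
next
  case (Suc m)
  then obtain c where hol: "\<And>k. c k holomorphic_on ball 0 1" and
    c: "\<And>x z. z \<in> ball 0 1 \<Longrightarrow> (deriv ^^ m) (laguerre_gf \<alpha> x) z
        = (\<Sum>k\<le>m. c k z * x ^ k) * laguerre_gf \<alpha> x z"
    by blast
  define u where "u = (\<lambda>k z. deriv (c k) z + complex_of_real (\<alpha> + 1) / (1 - z) * c k z)"
  define v where "v = (\<lambda>k z. - c k z / (1 - z)^2)"
  define d where "d = (\<lambda>k z. (if k \<le> m then u k z else 0) + (case k of 0 \<Rightarrow> 0 | Suc j \<Rightarrow> v j z))"
  have nz: "1 - z \<noteq> 0" if "z \<in> ball 0 1" for z :: complex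
    using that by auto
  have hu: "u k holomorphic_on ball 0 1" for k
    unfolding u_def using nz by (intro holomorphic_intros hol holomorphic_deriv) auto
  have hv: "v k holomorphic_on ball 0 1" for k
    unfolding v_def using nz by (intro holomorphic_intros hol) auto
  have hd: "d k holomorphic_on ball 0 1" for k
    unfolding d_def by (cases k; cases "k \<le> m") (auto intro!: holomorphic_intros hu hv)
  have "(deriv ^^ Suc m) (laguerre_gf \<alpha> x) z = (\<Sum>k\<le>Suc m. d k z * x ^ k) * laguerre_gf \<alpha> x z"
    if z: "z \<in> ball 0 1" for x z
  proof -
    have ev: "\<forall>\<^sub>F w in nhds z. (deriv ^^ m) (laguerre_gf \<alpha> x) w
        = (\<Sum>k\<le>m. c k w * x ^ k) * laguerre_gf \<alpha> x w"
      by (rule eventually_nhds_in_open[OF open_ball z, THEN eventually_mono]) (use c in auto)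
    have dc: "(c k has_field_derivative deriv (c k) z) (at z)" for k
      using hol z by (meson holomorphic_derivI open_ball)
    have s: "((\<lambda>w. \<Sum>k\<le>m. c k w * x ^ k) has_field_derivative
        (\<Sum>k\<le>m. deriv (c k) z * x ^ k)) (at z)"
      by (auto intro!: derivative_eq_intros dc)
    have "(deriv ^^ Suc m) (laguerre_gf \<alpha> x) z
        = deriv (\<lambda>w. (\<Sum>k\<le>m. c k w * x ^ k) * laguerre_gf \<alpha> x w) z"
      using deriv_cong_ev[OF ev refl] by simp
    also have "\<dots> = (\<Sum>k\<le>m. deriv (c k) z * x ^ k) * laguerre_gf \<alpha> x z
        + (complex_of_real (\<alpha> + 1) / (1 - z) - x / (1 - z)^2) * laguerre_gf \<alpha> x z
          * (\<Sum>k\<le>m. c k z * x ^ k)"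
      by (rule DERIV_imp_deriv[OF DERIV_mult[OF s laguerre_gf_deriv[OF z]]])
    also have "\<dots> = ((\<Sum>k\<le>m. u k z * x ^ k) + (\<Sum>k\<le>m. v k z * x ^ Suc k)) * laguerre_gf \<alpha> x z"
    proof -
      have "(\<Sum>k\<le>m. u k z * x ^ k) = (\<Sum>k\<le>m. deriv (c k) z * x ^ k)
          + complex_of_real (\<alpha> + 1) / (1 - z) * (\<Sum>k\<le>m. c k z * x ^ k)"
        by (simp only: u_def distrib_right sum.distrib sum_distrib_left mult.assoc)
      moreover have "(\<Sum>k\<le>m. v k z * x ^ Suc k) = - (x / (1 - z)^2) * (\<Sum>k\<le>m. c k z * x ^ k)"
        unfolding v_def sum_distrib_left by (rule sum.cong) simp_all
      moreover have "A * F + (B - C) * F * S = (A + B * S + - C * S) * F" for A B C F S :: complex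
        by (simp add: algebra_simps)
      ultimately show ?thesis by (simp only:)
    qed
    also have "(\<Sum>k\<le>m. u k z * x ^ k) + (\<Sum>k\<le>m. v k z * x ^ Suc k) = (\<Sum>k\<le>Suc m. d k z * x ^ k)"
    proof -
      have "(\<Sum>k\<le>Suc m. d k z * x ^ k) = (\<Sum>k\<le>Suc m. (if k \<le> m then u k z else 0) * x ^ k)
          + (\<Sum>k\<le>Suc m. (case k of 0 \<Rightarrow> 0 | Suc j \<Rightarrow> v j z) * x ^ k)"
        by (simp only: d_def distrib_right sum.distrib)
      moreover have "(\<Sum>k\<le>Suc m. (if k \<le> m then u k z else 0) * x ^ k) = (\<Sum>k\<le>m. u k z * x ^ k)"
        by simp
      moreover have "(\<Sum>k\<le>Suc m. (case k of 0 \<Rightarrow> 0 | Suc j \<Rightarrow> v j z) * x ^ k)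
          = (\<Sum>k\<le>m. v k z * x ^ Suc k)"
        by (subst sum.atMost_Suc_shift) simp
      ultimately show ?thesis by simp
    qed
    finally show ?thesis .
  qed
  with hd show ?case by (intro exI[of _ d] conjI allI ballI)
qed

lemma laguerre_unique_existence:
  "\<exists>!L :: nat \<Rightarrow> complex poly. \<forall>x z. norm z < 1 \<longrightarrow>
     (\<lambda>m. poly (L m) x * z ^ m) sums laguerre_gf \<alpha> x z"
proof -
  have "\<exists>p. \<forall>x. poly p x = (deriv ^^ m) (laguerre_gf \<alpha> x) 0 / fact m" for m
  proof -
    obtain c where c: "\<And>x z. z \<in> ball 0 1 \<Longrightarrow> (deriv ^^ m) (laguerre_gf \<alpha> x) z
        = (\<Sum>k\<le>m. c k z * x ^ k) * laguerre_gf \<alpha> x z"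
      using laguerre_gf_nth_deriv[of m \<alpha>] by blast
    show ?thesis
      by (rule exI[of _ "\<Sum>k\<le>m. monom (c k 0 / fact m) k"])
         (auto simp: c poly_sum poly_monom laguerre_gf_def sum_divide_distrib)
  qed
  then obtain L where L: "\<And>m x. poly (L m) x = (deriv ^^ m) (laguerre_gf \<alpha> x) 0 / fact m"
    by metis
  have hol: "laguerre_gf \<alpha> x holomorphic_on ball 0 1" for x
  proof -
    have "\<exists>D. (laguerre_gf \<alpha> x has_field_derivative D) (at z)" if "z \<in> ball 0 1" for z
      using laguerre_gf_deriv[OF that] by (rule exI)
    thus ?thesis by (simp only: holomorphic_on_open[OF open_ball]) simp
  qed
  have ex: "(\<lambda>m. poly (L m) x * z ^ m) sums laguerre_gf \<alpha> x z" if "norm z < 1" for x z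
    using holomorphic_power_series[OF hol, of z x] that by (simp add: L)
  show ?thesis
  proof (rule ex1I[of _ L])
    show "\<forall>x z. norm z < 1 \<longrightarrow> (\<lambda>m. poly (L m) x * z ^ m) sums laguerre_gf \<alpha> x z"
      using ex by blast
  next
    fix M :: "nat \<Rightarrow> complex poly"
    assume M: "\<forall>x z. norm z < 1 \<longrightarrow> (\<lambda>m. poly (M m) x * z ^ m) sums laguerre_gf \<alpha> x z"
    have "poly (M m) x = poly (L m) x" for m x
    proof -
      have 1: "(\<lambda>n. (poly (M n) x - poly (L n) x) * z ^ n) sums 0" if "norm z < 1" for z
        using sums_diff[OF M[rule_format, OF that, of x] ex[OF that, of x]]
        by (simp add: algebra_simps)
      have "poly (M m) x - poly (L m) x = 0"
      proof (rule ccontr)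
        assume nz: "poly (M m) x - poly (L m) x \<noteq> 0"
        have "poly (M 0) x - poly (L 0) x = 0"
          using 1[of 0] by (simp add: powser_sums_zero_iff)
        with nz have "m > 0" by (cases m) auto
        obtain s where s: "0 < s" "\<And>z::complex. z \<in> cball 0 s - {0} \<Longrightarrow> (0::complex) \<noteq> 0"
          by (rule powser_0_nonzero[of 1 0 "\<lambda>n. poly (M n) x - poly (L n) x" "\<lambda>_. 0" m])
             (use 1 nz \<open>m > 0\<close> in auto)
        have "complex_of_real s \<in> cball 0 s - {0}" using s(1) by simp
        thus False using s(2) by blast
      qed
      thus ?thesis by simp
    qed
    thus "M = L" by (intro ext poly_ext)
  qed
qed

end

theory Submission
  imports Defs
begin

text \<open>
  The proof compares Taylor coefficients in \<open>z\<close> on one fixed disc. Both the \<open>P\<^sub>m(x)\<close> and the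
  Laguerre polynomials are the Taylor coefficients at \<open>0\<close> of functions of \<open>z\<close>, namely of
  \<open>E (1 - z)\<^sup>n / G\<close> and \<open>E (1 - z)\<^sup>n / h\<close>, where \<open>E = exp (- z x / (1 - z))\<close>,
  \<open>h = (1 - z) powr (\<alpha> + n + 1)\<close> and \<open>G\<close> is the Laplace transform taken at \<open>z / (1 - z)\<close>.
  On the closed disc of radius \<open>r / 2\<close> the function \<open>h\<close> is bounded away from zero, hence so is
  \<open>G\<close> once \<open>\<omega>\<close> is near \<open>c\<close>. There the two quotients differ by
  \<open>E (1 - z)\<^sup>n (h - G) / (G h)\<close>, which is at most a constant times \<open>sup \<bar>h - G\<bar>\<close>, uniformly for
  bounded \<open>x\<close>, and Cauchy's inequality carries this bound over to each coefficient.

  The generating identity for \<open>P\<^sub>m\<close> holds only on a neighbourhood of \<open>0\<close> that may shrink with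
  \<open>\<omega>\<close> and \<open>x\<close>. The transfer to the fixed disc therefore rests on \<open>G\<close> being holomorphic
  there, that is, on the Laplace transform of a compactly supported distribution being entire
  (\<open>laplace_transform_entire\<close>). This holds because the Taylor expansion of \<open>exp (- s x)\<close> converges,
  together with all its \<open>x\<close>-derivatives, uniformly on compact sets, so that the
  distribution may be applied to it term by term.
\<close>

section \<open>Smooth functions on the line\<close>

text \<open>
  Iterated derivatives are defined through a choice operator, so a candidate for the whole sequence
  of derivatives has to be exhibited at once; each step then confirms the next member of it.
\<close>

lemma smooth_derivative_chain:
  assumes "\<And>k x. (D k has_vector_derivative D (Suc k) x) (at x)"
  shows nth_vderiv_derivative_chain: "nth_vderiv k (D 0) = D k"
    and smooth_derivative_chain_0: "smooth (D 0)"
proof -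
  have *: "nth_vderiv k (D 0) = D k" for k
  proof (induction k)
    case 0
    show ?case by (simp add: nth_vderiv_def)
  next
    case (Suc k)
    have "nth_vderiv (Suc k) (D 0) = (\<lambda>x. vector_derivative (nth_vderiv k (D 0)) (at x))"
      by (simp add: nth_vderiv_def)
    also have "\<dots> = D (Suc k)"
      unfolding Suc.IH using assms by (auto intro!: vector_derivative_at)
    finally show ?case .
  qed
  show "nth_vderiv k (D 0) = D k" by (rule *)
  show "smooth (D 0)"
    unfolding smooth_def * using assms by (metis differentiableI_vector)
qed

lemma smooth_poly_of_real: "smooth (\<lambda>x. poly p (complex_of_real x))"
proof -
  have "((\<lambda>x. poly ((pderiv ^^ k) p) (complex_of_real x)) has_vector_derivative
      poly ((pderiv ^^ Suc k) p) (complex_of_real x)) (at x)" for k x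
    using has_vector_derivative_real_field[OF poly_DERIV] by simp
  from smooth_derivative_chain_0[of "\<lambda>k x. poly ((pderiv ^^ k) p) (complex_of_real x)", OF this]
  show ?thesis by simp
qed

section \<open>Remainders of the exponential series\<close>

definition exp_tail :: "nat \<Rightarrow> complex \<Rightarrow> complex"
  where "exp_tail M w = exp w - (\<Sum>j<M. w ^ j / fact j)"

lemma exp_tail_0: "exp_tail 0 w = exp w"
  by (simp add: exp_tail_def)

lemma exp_tail_unfold: "exp_tail M w = w ^ M / fact M + exp_tail (Suc M) w"
  by (simp add: exp_tail_def)

text \<open>
  The truncated subtraction is what makes this uniform in \<open>M\<close>: the remainder of order
  \<open>0\<close> is \<open>exp\<close>, which is its own derivative.
\<close>

lemma DERIV_exp_tail: "(exp_tail M has_field_derivative exp_tail (M - 1) w) (at w)"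
proof (cases M)
  case 0
  then show ?thesis by (simp add: exp_tail_def[abs_def])
next
  case (Suc m)
  have "((\<lambda>w. \<Sum>j<Suc m. w ^ j / fact j) has_field_derivative (\<Sum>j<m. w ^ j / fact j)) (at w)"
  proof (induction m)
    case 0
    show ?case by simp
  next
    case (Suc m)
    have "((\<lambda>w. w ^ Suc m / fact (Suc m)) has_field_derivative
        of_nat (Suc m) * w ^ m / fact (Suc m)) (at w)"
      by (rule DERIV_cdivide) (auto intro!: derivative_eq_intros simp del: power_Suc)
    moreover have "of_nat (Suc m) * w ^ m / fact (Suc m) = w ^ m / fact m"
      by (simp add: field_simps del: of_nat_Suc)
    ultimately have "((\<lambda>w. w ^ Suc m / fact (Suc m)) has_field_derivative w ^ m / fact m) (at w)"
      by simp
    from DERIV_add[OF Suc.IH this] show ?case by simp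
  qed
  from DERIV_diff[OF DERIV_exp this] show ?thesis
    by (simp add: exp_tail_def[abs_def] Suc)
qed

text \<open>
  Taylor's theorem bounds the remainder of order \<open>m + 1\<close> by \<open>exp b * b ^ (m + 1) / fact m\<close>, which is
  a constant multiple of a term of the convergent series for \<open>exp b\<close>.
\<close>

lemma exp_tail_uniform_null_bound:
  assumes "0 \<le> b"
  obtains t where "t \<longlonglongrightarrow> 0" and "\<And>M w. norm w \<le> b \<Longrightarrow> norm (exp_tail M w) \<le> t M"
proof -
  define t where "t M = (case M of 0 \<Rightarrow> exp b | Suc m \<Rightarrow> exp b * b ^ Suc m / fact m)" for M
  have "(\<lambda>m. b ^ m / fact m) \<longlonglongrightarrow> 0"
    using summable_LIMSEQ_zero[OF summable_exp[of b]] by (simp add: divide_inverse mult.commute)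
  hence "(\<lambda>m. exp b * b * (b ^ m / fact m)) \<longlonglongrightarrow> exp b * b * 0"
    by (intro tendsto_intros)
  hence "(\<lambda>m. t (Suc m)) \<longlonglongrightarrow> 0"
    by (simp add: t_def mult.assoc)
  hence t: "t \<longlonglongrightarrow> 0"
    by (rule LIMSEQ_imp_Suc)
  have "norm (exp_tail M w) \<le> t M" if w: "norm w \<le> b" for M w
  proof (cases M)
    case 0
    show ?thesis
      using w norm_exp[of w] by (simp add: 0 t_def exp_tail_0 order_trans)
  next
    case (Suc m)
    have "norm (exp_tail M w) \<le> exp \<bar>Re w\<bar> * norm w ^ Suc m / fact m"
      using Taylor_exp[of w m] by (simp add: Suc exp_tail_def lessThan_Suc_atMost)
    also have "\<dots> \<le> exp b * b ^ Suc m / fact m"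
      using w abs_Re_le_cmod[of w] assms
      by (intro divide_right_mono mult_mono power_mono) auto
    finally show ?thesis by (simp add: Suc t_def)
  qed
  with t show thesis by (rule that)
qed

lemma exp_tail_of_real_derivative_chain:
  "((\<lambda>x. (- s) ^ k * exp_tail (M - k) (- (s * complex_of_real x))) has_vector_derivative
     (- s) ^ Suc k * exp_tail (M - Suc k) (- (s * complex_of_real x))) (at x)"
proof -
  have "((\<lambda>w. (- s) ^ k * exp_tail (M - k) (- (s * w))) has_field_derivative
      (- s) ^ k * (exp_tail (M - k - 1) (- (s * w)) * - s)) (at w)" for w
    by (rule DERIV_cmult[OF DERIV_chain2[OF DERIV_exp_tail]]) (auto intro!: derivative_eq_intros)
  from has_vector_derivative_real_field[OF this]
  show ?thesis by (simp add: mult_ac)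
qed

lemma smooth_exp_tail: "smooth (\<lambda>x. exp_tail M (- (s * complex_of_real x)))"
  using smooth_derivative_chain_0[of "\<lambda>k x. (- s) ^ k * exp_tail (M - k) (- (s * complex_of_real x))",
      OF exp_tail_of_real_derivative_chain] by simp

lemma nth_vderiv_exp_tail:
  "nth_vderiv k (\<lambda>x. exp_tail M (- (s * complex_of_real x)))
     = (\<lambda>x. (- s) ^ k * exp_tail (M - k) (- (s * complex_of_real x)))"
  using nth_vderiv_derivative_chain[of "\<lambda>k x. (- s) ^ k * exp_tail (M - k) (- (s * complex_of_real x))" k,
      OF exp_tail_of_real_derivative_chain] by simp

section \<open>The Laplace transform is entire\<close>

text \<open>
  The exponential series converges to \<open>exp (- s x)\<close> in the topology of the space of smooth functions:
  the \<open>k\<close>-th derivative of the remainder of order \<open>J\<close> is \<open>(- s)\<^sup>k\<close> times the remainder of order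
  \<open>J - k\<close>, and only finitely many \<open>k\<close> enter the continuity estimate.
\<close>

lemma distribution_exp_tail_tendsto_0:
  assumes "compactly_supported_distribution \<phi>"
  shows "(\<lambda>J. \<phi> (\<lambda>x. exp_tail J (- (s * complex_of_real x)))) \<longlonglongrightarrow> 0"
proof -
  obtain K N C where K: "compact K" "K \<noteq> {}" and cont:
    "\<And>f. smooth f \<Longrightarrow> norm (\<phi> f) \<le> C * (\<Sum>k\<le>N. SUP x\<in>K. norm (nth_vderiv k f x))"
    using assms unfolding compactly_supported_distribution_def by blast
  obtain B where B: "B > 0" "\<And>x. x \<in> K \<Longrightarrow> norm x \<le> B"
    using compact_imp_bounded[OF K(1)] by (meson bounded_pos)
  define p where "p J k = (SUP x\<in>K. norm (nth_vderiv k (\<lambda>x. exp_tail J (- (s * complex_of_real x))) x))"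
    for J k
  obtain t where t: "t \<longlonglongrightarrow> 0" and bound: "\<And>M w. norm w \<le> norm s * B \<Longrightarrow> norm (exp_tail M w) \<le> t M"
    using exp_tail_uniform_null_bound[of "norm s * B"] B(1) by auto
  have p_le: "norm (nth_vderiv k (\<lambda>x. exp_tail J (- (s * complex_of_real x))) x) \<le> norm s ^ k * t (J - k)"
    if "x \<in> K" for J k x
  proof -
    have "norm (- (s * complex_of_real x)) \<le> norm s * B"
      using B(2)[OF that] by (simp add: norm_mult mult_left_mono)
    from bound[OF this, of "J - k"] show ?thesis
      by (simp add: nth_vderiv_exp_tail norm_mult norm_power mult_left_mono)
  qed
  have "(\<lambda>J. p J k) \<longlonglongrightarrow> 0" for k
  proof (rule tendsto_sandwich)
    obtain x0 where "x0 \<in> K" using K(2) by blast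
    show "\<forall>\<^sub>F J in sequentially. 0 \<le> p J k"
      unfolding p_def
      by (intro always_eventually allI cSUP_upper2[OF _ \<open>x0 \<in> K\<close>] bdd_aboveI2[OF p_le]) auto
    show "\<forall>\<^sub>F J in sequentially. p J k \<le> norm s ^ k * t (J - k)"
      unfolding p_def by (intro always_eventually allI cSUP_least K(2) p_le)
    have "(\<lambda>J. t (J - k)) \<longlonglongrightarrow> 0"
      by (rule LIMSEQ_offset[of _ k]) (simp add: t)
    thus "(\<lambda>J. norm s ^ k * t (J - k)) \<longlonglongrightarrow> 0"
      by (rule tendsto_mult_right_zero)
  qed simp
  hence "(\<lambda>J. C * (\<Sum>k\<le>N. p J k)) \<longlonglongrightarrow> 0"
    by (intro tendsto_mult_right_zero tendsto_null_sum) auto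
  moreover have "norm (\<phi> (\<lambda>x. exp_tail J (- (s * complex_of_real x)))) \<le> C * (\<Sum>k\<le>N. p J k)" for J
    unfolding p_def by (rule cont[OF smooth_exp_tail])
  ultimately show ?thesis
    by (rule Lim_null_comparison[OF always_eventually[OF allI], rotated])
qed

text \<open>
  Splitting off one Taylor term at a time uses the linearity of \<open>\<phi>\<close>, and the remainder tends to
  zero by continuity. The coefficients are the moments of \<open>\<phi>\<close> up to sign and factorials.
\<close>

lemma laplace_transform_sums:
  assumes "compactly_supported_distribution \<phi>"
  shows "(\<lambda>j. \<phi> (\<lambda>x. (- complex_of_real x) ^ j / fact j) * s ^ j) sums laplace_transform \<phi> s"
proof -
  define a where "a j = \<phi> (\<lambda>x. (- complex_of_real x) ^ j / fact j)" for j
  define R where "R J = \<phi> (\<lambda>x. exp_tail J (- (s * complex_of_real x)))" for J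
  note linear = assms[unfolded compactly_supported_distribution_def]
  note add = linear[THEN conjunct1, rule_format]
  note scale = linear[THEN conjunct2, THEN conjunct1, rule_format]
  have step: "R J = a J * s ^ J + R (Suc J)" for J
  proof -
    have sm: "smooth (\<lambda>x. b * ((- complex_of_real x) ^ J / fact J))" for b
      using smooth_poly_of_real[of "smult (b / fact J) ([:0, -1:] ^ J)"]
      by (simp add: poly_power mult_ac)
    have "(- (s * complex_of_real x)) ^ J = s ^ J * (- complex_of_real x) ^ J" for x
      by (simp flip: power_mult_distrib)
    hence expand: "exp_tail J (- (s * complex_of_real x)) =
        s ^ J * ((- complex_of_real x) ^ J / fact J) + exp_tail (Suc J) (- (s * complex_of_real x))"
      for x
      by (subst exp_tail_unfold) simp
    have "R J = \<phi> (\<lambda>x. s ^ J * ((- complex_of_real x) ^ J / fact J)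
        + exp_tail (Suc J) (- (s * complex_of_real x)))"
      unfolding R_def by (simp only: expand)
    also have "\<dots> = s ^ J * a J + R (Suc J)"
      unfolding a_def R_def
      by (subst add[OF sm smooth_exp_tail], subst scale) (use sm[of 1] in simp_all)
    finally show ?thesis by (simp add: mult.commute)
  qed
  have "(\<Sum>j<J. a j * s ^ j) = laplace_transform \<phi> s - R J" for J
  proof (induction J)
    case 0
    show ?case by (simp add: R_def laplace_transform_def exp_tail_0)
  next
    case (Suc J)
    then show ?case by (simp add: step[of J])
  qed
  moreover have "(\<lambda>J. laplace_transform \<phi> s - R J) \<longlonglongrightarrow> laplace_transform \<phi> s - 0"
    unfolding R_def by (intro tendsto_diff tendsto_const distribution_exp_tail_tendsto_0 assms)
  ultimately show ?thesis
    by (simp add: sums_def a_def)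
qed

lemma laplace_transform_entire:
  assumes "compactly_supported_distribution \<phi>"
  shows "laplace_transform \<phi> holomorphic_on A"
proof -
  have "laplace_transform \<phi> holomorphic_on ball 0 R" for R
    by (rule power_series_holomorphic[where a = "\<lambda>j. \<phi> (\<lambda>x. (- complex_of_real x) ^ j / fact j)"])
       (simp add: laplace_transform_sums[OF assms])
  hence "laplace_transform \<phi> field_differentiable at w" for w
    using holomorphic_on_imp_differentiable_at[OF _ open_ball, of "laplace_transform \<phi>" 0 "norm w + 1" w]
    by simp
  thus ?thesis
    by (simp add: holomorphic_on_def field_differentiable_at_within)
qed

section \<open>Coefficient bounds and convergence\<close>

text \<open>
  Cauchy's inequality on a disc on which \<open>f\<close> is holomorphic, although the series is only known to
  represent \<open>f\<close> near the centre: the coefficients are determined by the germ of \<open>f\<close> at \<open>0\<close>.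
\<close>

lemma power_series_coeff_bound:
  fixes f :: "complex \<Rightarrow> complex"
  assumes sums: "\<forall>\<^sub>F z in nhds 0. (\<lambda>m. a m * z ^ m) sums f z"
    and hol: "f holomorphic_on cball 0 \<rho>" and "0 < \<rho>"
    and bound: "\<And>z. norm z \<le> \<rho> \<Longrightarrow> norm (f z) \<le> B"
  shows "norm (a m) \<le> B / \<rho> ^ m"
proof -
  obtain e where e: "e > 0" "\<And>z. norm z < e \<Longrightarrow> (\<lambda>m. a m * z ^ m) sums f z"
    using sums unfolding eventually_nhds_metric by (auto simp: dist_norm)
  have "f has_fps_expansion Abs_fps a"
  proof (rule has_fps_expansionI)
    have "\<forall>\<^sub>F z in nhds 0. z \<in> ball (0::complex) e"
      using e(1) by (intro eventually_nhds_in_open) auto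
    thus "\<forall>\<^sub>F z in nhds 0. (\<lambda>n. fps_nth (Abs_fps a) n * z ^ n) sums f z"
      by (rule eventually_mono) (use e(2) in auto)
  qed
  hence "a m = (deriv ^^ m) f 0 / fact m"
    using fps_nth_fps_expansion[of f "Abs_fps a" m] by simp
  moreover have "norm ((deriv ^^ m) f 0) / fact m \<le> fact m * B / \<rho> ^ m / fact m"
  proof (rule divide_right_mono)
    show "norm ((deriv ^^ m) f 0) \<le> fact m * B / \<rho> ^ m"
      by (rule Cauchy_inequality)
         (use assms hol in \<open>auto intro: holomorphic_on_subset holomorphic_on_imp_continuous_on\<close>)
  qed simp
  ultimately show ?thesis
    by (simp add: norm_divide)
qed

lemma gen_laguerre_sums:
  assumes "norm z < 1"
  shows "(\<lambda>m. poly (gen_laguerre \<alpha> m) x * z ^ m) sums laguerre_gf \<alpha> x z"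
  using theI'[OF laguerre_unique_existence[of \<alpha>]] assms
  unfolding gen_laguerre_def[symmetric] by blast

lemma one_minus_notin_nonpos_Reals:
  fixes z :: complex
  assumes "norm z < 1"
  shows "1 - z \<notin> \<real>\<^sub>\<le>\<^sub>0"
  using assms abs_Re_le_cmod[of z] by (auto simp: complex_nonpos_Reals_iff)

lemma laguerre_gf_eq_quotient:
  assumes "norm z < 1"
  shows "laguerre_gf \<alpha> x z = exp (- (z * x / (1 - z))) * (1 - z) ^ n
           / (1 - z) powr complex_of_real (\<alpha> + real n + 1)"
proof -
  have nz: "1 - z \<noteq> 0" using assms by auto
  have "(1 - z) powr complex_of_real (- \<alpha> - 1) * (1 - z) powr complex_of_real (\<alpha> + real n + 1)
      = (1 - z) powr of_nat n"
    by (simp flip: powr_add)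
  also have "\<dots> = (1 - z) ^ n"
    using nz by (simp add: powr_nat')
  finally show ?thesis
    using nz by (simp add: laguerre_gf_def field_simps)
qed

lemma exp_quotient_bound:
  fixes z x :: complex
  assumes "norm z \<le> \<rho>" and "\<rho> < 1" and "norm x \<le> X"
  shows "norm (exp (- (z * x / (1 - z)))) \<le> exp (X / (1 - \<rho>))"
proof -
  have "1 - \<rho> \<le> norm (1 - z)"
    using assms norm_triangle_ineq2[of 1 z] by simp
  hence "norm (z * x / (1 - z)) \<le> 1 * X / (1 - \<rho>)"
    unfolding norm_divide norm_mult using assms order_trans[OF norm_ge_zero assms(3)]
    by (intro frac_le mult_mono) auto
  moreover have "norm (exp (- (z * x / (1 - z)))) \<le> exp (norm (- (z * x / (1 - z))))"
    by (rule norm_exp)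
  ultimately show ?thesis
    by (smt (verit) exp_le_cancel_iff norm_minus_cancel mult_1)
qed

theorem theorem5p1:
  fixes \<alpha> c r :: real and n :: nat and \<Omega> :: "real set"
    and \<phi> :: "real \<Rightarrow> (real \<Rightarrow> complex) \<Rightarrow> complex"
    and P :: "nat \<Rightarrow> real \<Rightarrow> complex poly"
  assumes "c islimpt \<Omega>"
    and "\<And>\<omega>. \<omega> \<in> \<Omega> \<Longrightarrow> compactly_supported_distribution (\<phi> \<omega>)"
    and "\<And>\<omega>. \<omega> \<in> \<Omega> \<Longrightarrow> laplace_transform (\<phi> \<omega>) 0 \<noteq> 0"
    and "0 < r" and "r < 1"
    and "\<forall>\<epsilon>>0. \<exists>\<delta>>0. \<forall>\<omega>\<in>\<Omega>. \<bar>\<omega> - c\<bar> < \<delta> \<longrightarrow>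
           (\<forall>z::complex. norm z < r \<longrightarrow>
              norm (laplace_transform (\<phi> \<omega>) (z / (1 - z))
                    - (1 - z) powr complex_of_real (\<alpha> + real n + 1)) \<le> \<epsilon>)"
    and "\<And>\<omega> x. \<omega> \<in> \<Omega> \<Longrightarrow>
           \<forall>\<^sub>F z in nhds (0::complex).
             (\<lambda>m. poly (P m \<omega>) x * z ^ m) sums
               (exp (- (z * x / (1 - z))) * (1 - z) ^ n / laplace_transform (\<phi> \<omega>) (z / (1 - z)))"
  shows "\<forall>m. \<forall>x\<^sub>0. \<exists>U. open U \<and> x\<^sub>0 \<in> U \<and>
           uniform_limit U (\<lambda>\<omega> x. poly (P m \<omega>) x) (\<lambda>x. poly (gen_laguerre \<alpha> m) x)
             (at c within \<Omega>)"
proof (intro allI)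
  fix m :: nat and x\<^sub>0 :: complex
  \<comment> \<open>The hypothesis controls only the open disc of radius \<open>r\<close>; Cauchy's inequality and the lower
    bound for \<open>h\<close> use a compact disc inside it.\<close>
  define \<rho> where "\<rho> = r / 2"
  have \<rho>: "0 < \<rho>" "\<rho> < r" "\<rho> < 1" using assms(4,5) by (auto simp: \<rho>_def)
  define h where "h z = (1 - z) powr complex_of_real (\<alpha> + real n + 1)" for z
  define X where "X = norm x\<^sub>0 + 1"
  have nz: "1 - z \<noteq> 0" if "norm z \<le> \<rho>" for z :: complex using that \<rho> by auto
  have hol_h: "h holomorphic_on cball 0 \<rho>"
    unfolding h_def using \<rho> by (intro holomorphic_intros one_minus_notin_nonpos_Reals) auto
  have h_nz: "h z \<noteq> 0" if "norm z \<le> \<rho>" for z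
    using nz[OF that] by (simp add: h_def)
  obtain \<mu> where \<mu>: "\<mu> > 0" "\<And>z. norm z \<le> \<rho> \<Longrightarrow> \<mu> \<le> norm (h z)"
  proof -
    have "continuous_on (cball 0 \<rho>) (\<lambda>z. norm (h z))"
      by (intro continuous_intros holomorphic_on_imp_continuous_on hol_h)
    then obtain z0 where "z0 \<in> cball 0 \<rho>" "\<And>z. z \<in> cball 0 \<rho> \<Longrightarrow> norm (h z0) \<le> norm (h z)"
      using continuous_attains_inf[of "cball (0::complex) \<rho>" "\<lambda>z. norm (h z)"] \<rho> by auto
    thus thesis using that[of "norm (h z0)"] h_nz by auto
  qed
  \<comment> \<open>The factors bound, in this order, the exponential, \<open>(1 - z) ^ n\<close>, and \<open>1 / (G h)\<close> on the disc of
    radius \<open>\<rho>\<close>, where \<open>\<bar>G\<bar> \<ge> \<mu> / 2\<close> and \<open>\<bar>h\<bar> \<ge> \<mu>\<close>.\<close>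
  define Q where "Q = exp (X / (1 - \<rho>)) * 2 ^ n / (\<mu> / 2 * \<mu>)"
  have Q: "Q > 0" using \<mu>(1) by (simp add: Q_def)
  have close: "norm (poly (P m \<omega>) x - poly (gen_laguerre \<alpha> m) x) \<le> Q * \<eta> / \<rho> ^ m"
    if \<omega>: "\<omega> \<in> \<Omega>" and \<eta>: "\<eta> \<le> \<mu> / 2" and x: "norm x \<le> X"
      and near: "\<And>z. norm z < r \<Longrightarrow> norm (laplace_transform (\<phi> \<omega>) (z / (1 - z)) - h z) \<le> \<eta>"
    for \<omega> x \<eta>
  proof -
    define G where "G z = laplace_transform (\<phi> \<omega>) (z / (1 - z))" for z
    define E where "E z = exp (- (z * x / (1 - z)))" for z
    define D where "D z = E z * (1 - z) ^ n / G z - E z * (1 - z) ^ n / h z" for z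
    have G_ge: "\<mu> / 2 \<le> norm (G z)" if z: "norm z \<le> \<rho>" for z
    proof -
      have "norm (G z - h z) \<le> \<mu> / 2"
        using near[of z] z \<rho> \<eta> by (simp add: G_def)
      moreover have "norm (h z) - norm (G z) \<le> norm (G z - h z)"
        by (metis norm_minus_commute norm_triangle_ineq2)
      ultimately show ?thesis using \<mu>(2)[OF z] by linarith
    qed
    have G_nz: "G z \<noteq> 0" if "norm z \<le> \<rho>" for z
      using G_ge[OF that] \<mu>(1) by auto
    have hol_G: "G holomorphic_on cball 0 \<rho>"
    proof -
      have "laplace_transform (\<phi> \<omega>) \<circ> (\<lambda>z. z / (1 - z)) holomorphic_on cball 0 \<rho>"
        using nz by (intro holomorphic_on_compose laplace_transform_entire[OF assms(2)[OF \<omega>]]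
            holomorphic_intros) auto
      thus ?thesis by (simp add: G_def[abs_def] o_def)
    qed
    have hol_D: "D holomorphic_on cball 0 \<rho>"
      unfolding D_def E_def using G_nz h_nz nz
      by (intro holomorphic_intros hol_G hol_h) auto
    have "\<forall>\<^sub>F z in nhds (0::complex). z \<in> ball 0 1"
      by (intro eventually_nhds_in_open) auto
    hence ev: "\<forall>\<^sub>F z in nhds 0.
        (\<lambda>m. (poly (P m \<omega>) x - poly (gen_laguerre \<alpha> m) x) * z ^ m) sums D z"
      using assms(7)[OF \<omega>, of x]
    proof eventually_elim
      case (elim z)
      hence "norm z < 1" by simp
      from sums_diff[OF elim(2) gen_laguerre_sums[OF this, of \<alpha> x]]
      show ?case
        using laguerre_gf_eq_quotient[OF \<open>norm z < 1\<close>, of \<alpha> x n]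
        by (simp add: D_def E_def G_def h_def left_diff_distrib)
    qed
    have D_bound: "norm (D z) \<le> Q * \<eta>" if z: "norm z \<le> \<rho>" for z
    proof -
      have \<eta>0: "0 \<le> \<eta>"
        using near[of z] z \<rho> by (intro order_trans[OF norm_ge_zero]) auto
      have "D z = E z * (1 - z) ^ n * (h z - G z) / (G z * h z)"
        using G_nz[OF z] h_nz[OF z] by (simp add: D_def field_simps)
      hence "norm (D z) = norm (E z) * norm (1 - z) ^ n * norm (h z - G z) / (norm (G z) * norm (h z))"
        by (simp add: norm_mult norm_divide norm_power)
      also have "\<dots> \<le> exp (X / (1 - \<rho>)) * 2 ^ n * \<eta> / (\<mu> / 2 * \<mu>)"
      proof (intro frac_le mult_mono power_mono)
        show "norm (E z) \<le> exp (X / (1 - \<rho>))"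
          unfolding E_def by (rule exp_quotient_bound[OF z \<rho>(3) x])
        show "norm (1 - z) \<le> 2"
          using norm_triangle_ineq4[of 1 z] z \<rho> by simp
        show "norm (h z - G z) \<le> \<eta>"
          using near[of z] z \<rho> by (simp add: G_def norm_minus_commute)
      qed (use \<mu> \<eta>0 z G_ge in auto)
      also have "\<dots> = Q * \<eta>" by (simp add: Q_def)
      finally show ?thesis .
    qed
    show ?thesis
      by (rule power_series_coeff_bound[OF ev hol_D \<rho>(1) D_bound])
  qed
  have "uniform_limit (ball x\<^sub>0 1) (\<lambda>\<omega> x. poly (P m \<omega>) x) (\<lambda>x. poly (gen_laguerre \<alpha> m) x)
      (at c within \<Omega>)"
  proof (rule uniform_limitI)
    fix e :: real assume e: "e > 0"
    \<comment> \<open>The second entry gives \<open>Q * \<eta> / \<rho> ^ m \<le> e / 2\<close>, the first keeps \<open>G\<close> away from \<open>0\<close>.\<close>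
    define \<eta> where "\<eta> = min (\<mu> / 2) (e / 2 * \<rho> ^ m / Q)"
    have "\<eta> > 0" using \<mu>(1) e Q \<rho> by (simp add: \<eta>_def)
    then obtain \<delta> where \<delta>: "\<delta> > 0" "\<And>\<omega> z. \<lbrakk>\<omega> \<in> \<Omega>; \<bar>\<omega> - c\<bar> < \<delta>; norm z < r\<rbrakk> \<Longrightarrow>
        norm (laplace_transform (\<phi> \<omega>) (z / (1 - z)) - h z) \<le> \<eta>"
      using assms(6) unfolding h_def by meson
    have "dist (poly (P m \<omega>) x) (poly (gen_laguerre \<alpha> m) x) < e"
      if "\<omega> \<in> \<Omega>" "dist \<omega> c < \<delta>" "x \<in> ball x\<^sub>0 1" for \<omega> x
    proof -
      have "norm x \<le> X"
        using that(3) norm_triangle_sub[of x x\<^sub>0] by (simp add: X_def dist_norm norm_minus_commute)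
      hence "norm (poly (P m \<omega>) x - poly (gen_laguerre \<alpha> m) x) \<le> Q * \<eta> / \<rho> ^ m"
        using that \<delta>(2) by (intro close) (auto simp: \<eta>_def dist_real_def)
      also have "\<dots> \<le> Q * (e / 2 * \<rho> ^ m / Q) / \<rho> ^ m"
        using Q \<rho> by (intro divide_right_mono mult_left_mono) (auto simp: \<eta>_def)
      also have "\<dots> < e"
        using Q \<rho> e by simp
      finally show ?thesis by (simp add: dist_norm)
    qed
    thus "\<forall>\<^sub>F \<omega> in at c within \<Omega>. \<forall>x\<in>ball x\<^sub>0 1.
        dist (poly (P m \<omega>) x) (poly (gen_laguerre \<alpha> m) x) < e"
      unfolding eventually_at using \<delta>(1) by blast
  qed
  thus "\<exists>U. open U \<and> x\<^sub>0 \<in> U \<and>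
      uniform_limit U (\<lambda>\<omega> x. poly (P m \<omega>) x) (\<lambda>x. poly (gen_laguerre \<alpha> m) x) (at c within \<Omega>)"
    by (intro exI[of _ "ball x\<^sub>0 1"]) simp
qed

end
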